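(* Let $\mathbb{F}$ be a field. Up to isomorphism there are exactly two nilpotent evolution algebras of dimension $2$ over $\mathbb{F}$, namely the following two algebras with natural basis $\{e_1,e_2\}$ (only the nonzero products of basis elements are listed), which are not isomorphic to each other: (1) $\mathcal{E}_{2,1}$: all products are zero. Here $\mathcal{B}(\mathcal{E}_{2,1}\times\mathcal{E}_{2,1},\mathbb{F})=0$, $\mathcal{H}(\mathcal{E}_{2,1}\times\mathcal{E}_{2,1},\mathbb{F})=\langle\delta_{e_1,e_1},\delta_{e_2,e_2}\rangle$, $ann(\mathcal{E}_{2,1})=\mathcal{E}_{2,1}$ and $Aut(\mathcal{E}_{2,1})=GL(\mathcal{E}_{2,1})$. (2) $\mathcal{E}_{2,2}$: $e_1^2=e_2$. Here $\mathcal{B}(\mathcal{E}_{2,2}\times\mathcal{E}_{2,2},\mathbb{F})=\langle\delta_{e_1,e_1}\rangle$, $\mathcal{H}(\mathcal{E}_{2,2}\times\mathcal{E}_{2,2},\mathbb{F})=\langle\delta_{e_2,e_2}\rangle$, $ann(\mathcal{E}_{2,2})=\langle e_2\rangle$, and $Aut(\mathcal{E}_{2,2})$ consists of the invertible linear maps with matrix $\begin{bmatrix} a_{11}&0\\ a_{21}&a_{11}^2\end{bmatrix}$.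
   Context: An evolution algebra over a field $\mathbb{F}$ is a (finite-dimensional, not necessarily associative) algebra $\mathcal{E}$ having a vector space basis $\{e_1,\dots,e_n\}$, called a natural basis, with $e_ie_j=0$ for all $i\neq j$. Put $\mathcal{E}^{\langle 1\rangle}=\mathcal{E}$ and $\mathcal{E}^{\langle k+1\rangle}=\mathcal{E}^{\langle k\rangle}\mathcal{E}$ (span of products); $\mathcal{E}$ is nilpotent if $\mathcal{E}^{\langle n\rangle}=0$ for some $n\ge 1$. The annihilator is $ann(\mathcal{E})=\{x\in\mathcal{E}: x\mathcal{E}=0\}$. Isomorphism means isomorphism of $\mathbb{F}$-algebras, and $Aut(\mathcal{E})$ is the group of algebra automorphisms. For an evolution algebra $\mathcal{E}$ with fixed natural basis $\{e_1,\dots,e_m\}$, let $\mathcal{Z}(\mathcal{E}\times\mathcal{E},\mathbb{F})$ be the space of bilinear forms $\theta$ on $\mathcal{E}$ with $\theta(e_i,e_j)=0$ for all $i\ne j$; let $\mathcal{B}(\mathcal{E}\times\mathcal{E},\mathbb{F})$ be the subspace of the forms $\theta_f(x,y)=f(xy)$ with $f\in Hom(\mathcal{E},\mathbb{F})$; and $\mathcal{H}(\mathcal{E}\times\mathcal{E},\mathbb{F})=\mathcal{Z}(\mathcal{E}\times\mathcal{E},\mathbb{F})/\mathcal{B}(\mathcal{E}\times\mathcal{E},\mathbb{F})$. The form $\delta_{e_i,e_i}$ takes the value $1$ on $(e_i,e_i)$ and $0$ on all other pairs of basis elements; when it occurs as an element of $\mathcal{H}$, its class is meant. $\langle\cdot\rangle$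 denotes linear span. A linear map $\phi$ has matrix $(a_{ij})$ if $\phi(e_j)=\sum_i a_{ij}e_i$. *)

theory Defs
  imports "HOL-Analysis.Analysis" "HOL-Library.Function_Algebras" "HOL-Library.Set_Algebras"
begin

definition bilinear_map ::
  "('a::field \<Rightarrow> 'v::ab_group_add \<Rightarrow> 'v) \<Rightarrow> ('a \<Rightarrow> 'w::ab_group_add \<Rightarrow> 'w) \<Rightarrow> ('v \<Rightarrow> 'v \<Rightarrow> 'w) \<Rightarrow> bool"
  where "bilinear_map s t \<beta> \<longleftrightarrow>
    (\<forall>y. Vector_Spaces.linear s t (\<lambda>x. \<beta> x y)) \<and> (\<forall>x. Vector_Spaces.linear s t (\<lambda>y. \<beta> x y))"

text \<open>
  An algebra is given by a scalar multiplication \<open>s\<close> on a type and a product \<open>m\<close> with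
  \<open>bilinear_map s s m\<close>; its carrier is the whole type. Since \<open>Vector_Spaces.linear\<close> is a
  locale predicate that includes the vector space axioms, \<open>bilinear_map s s m\<close> also says that
  \<open>s\<close> makes the type a vector space. The predicate \<open>finite_dimensional_vector_space s N\<close>
  below says that \<open>N\<close> is a finite basis of that space.
\<close>

definition natural_basis ::
  "('a::field \<Rightarrow> 'v::ab_group_add \<Rightarrow> 'v) \<Rightarrow> ('v \<Rightarrow> 'v \<Rightarrow> 'v) \<Rightarrow> 'v set \<Rightarrow> bool"
  where "natural_basis s m N \<longleftrightarrow>
    finite_dimensional_vector_space s N \<and> (\<forall>x\<in>N. \<forall>y\<in>N. x \<noteq> y \<longrightarrow> m x y = 0)"

definition evolution_algebra ::
  "('a::field \<Rightarrow> 'v::ab_group_add \<Rightarrow> 'v) \<Rightarrow> ('v \<Rightarrow> 'v \<Rightarrow> 'v) \<Rightarrow> bool"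
  where "evolution_algebra s m \<longleftrightarrow> bilinear_map s s m \<and> (\<exists>N. natural_basis s m N)"

text \<open>The powers are indexed from 1; the value at 0 is a dummy.\<close>

fun right_power ::
  "('a::field \<Rightarrow> 'v::ab_group_add \<Rightarrow> 'v) \<Rightarrow> ('v \<Rightarrow> 'v \<Rightarrow> 'v) \<Rightarrow> nat \<Rightarrow> 'v set"
  where
    "right_power s m 0 = UNIV"
  | "right_power s m (Suc 0) = UNIV"
  | "right_power s m (Suc (Suc k)) = module.span s {m x y | x y. x \<in> right_power s m (Suc k)}"

definition nilpotent_algebra ::
  "('a::field \<Rightarrow> 'v::ab_group_add \<Rightarrow> 'v) \<Rightarrow> ('v \<Rightarrow> 'v \<Rightarrow> 'v) \<Rightarrow> bool"
  where "nilpotent_algebra s m \<longleftrightarrow> (\<exists>n\<ge>1. right_power s m n = {0})"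

definition annihilator :: "('v \<Rightarrow> 'v \<Rightarrow> 'v::zero) \<Rightarrow> 'v set"
  where "annihilator m = {x. \<forall>y. m x y = 0}"

definition algebra_iso ::
  "('a::field \<Rightarrow> 'v::ab_group_add \<Rightarrow> 'v) \<Rightarrow> ('v \<Rightarrow> 'v \<Rightarrow> 'v) \<Rightarrow>
   ('a \<Rightarrow> 'w::ab_group_add \<Rightarrow> 'w) \<Rightarrow> ('w \<Rightarrow> 'w \<Rightarrow> 'w) \<Rightarrow> ('v \<Rightarrow> 'w) \<Rightarrow> bool"
  where "algebra_iso s m s' m' \<phi> \<longleftrightarrow>
    Vector_Spaces.linear s s' \<phi> \<and> bij \<phi> \<and> (\<forall>x y. \<phi> (m x y) = m' (\<phi> x) (\<phi> y))"

definition isomorphic_algebras ::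
  "('a::field \<Rightarrow> 'v::ab_group_add \<Rightarrow> 'v) \<Rightarrow> ('v \<Rightarrow> 'v \<Rightarrow> 'v) \<Rightarrow>
   ('a \<Rightarrow> 'w::ab_group_add \<Rightarrow> 'w) \<Rightarrow> ('w \<Rightarrow> 'w \<Rightarrow> 'w) \<Rightarrow> bool"
  where "isomorphic_algebras s m s' m' \<longleftrightarrow> (\<exists>\<phi>. algebra_iso s m s' m' \<phi>)"

definition general_linear_maps ::
  "('a::field \<Rightarrow> 'v::ab_group_add \<Rightarrow> 'v) \<Rightarrow> ('v \<Rightarrow> 'v) set"
  where "general_linear_maps s = {\<phi>. Vector_Spaces.linear s s \<phi> \<and> bij \<phi>}"

definition algebra_auts ::
  "('a::field \<Rightarrow> 'v::ab_group_add \<Rightarrow> 'v) \<Rightarrow> ('v \<Rightarrow> 'v \<Rightarrow> 'v) \<Rightarrow> ('v \<Rightarrow> 'v) set"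
  where "algebra_auts s m = {\<phi>. algebra_iso s m s m \<phi>}"


text \<open>Two-argument functions form a vector space pointwise, with span \<open>forms.span\<close>.\<close>

definition form_scale :: "'a::field \<Rightarrow> ('v \<Rightarrow> 'v \<Rightarrow> 'a) \<Rightarrow> 'v \<Rightarrow> 'v \<Rightarrow> 'a"
  where "form_scale c \<theta> = (\<lambda>x y. c * \<theta> x y)"

interpretation forms: vector_space form_scale
  by standard (simp_all add: form_scale_def fun_eq_iff algebra_simps)

definition Z_forms ::
  "('a::field \<Rightarrow> 'v::ab_group_add \<Rightarrow> 'v) \<Rightarrow> 'v set \<Rightarrow> ('v \<Rightarrow> 'v \<Rightarrow> 'a) set"
  where "Z_forms s N =
    {\<theta>. bilinear_map s (*) \<theta> \<and> (\<forall>x\<in>N. \<forall>y\<in>N. x \<noteq> y \<longrightarrow> \<theta> x y = 0)}"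

definition B_forms ::
  "('a::field \<Rightarrow> 'v::ab_group_add \<Rightarrow> 'v) \<Rightarrow> ('v \<Rightarrow> 'v \<Rightarrow> 'v) \<Rightarrow> ('v \<Rightarrow> 'v \<Rightarrow> 'a) set"
  where "B_forms s m = {\<lambda>x y. f (m x y) | f. Vector_Spaces.linear s (*) f}"

text \<open>
  The form \<open>\<delta>\<^sub>b\<^sub>,\<^sub>b\<close> attached to an element \<open>b\<close> of the basis \<open>N\<close>, in coordinates:
  \<open>module.representation s N x b\<close> is the \<open>b\<close>-coordinate of \<open>x\<close>.
  The two lemmas confirm that it is the expected bilinear form.
\<close>

definition delta_form ::
  "('a::field \<Rightarrow> 'v::ab_group_add \<Rightarrow> 'v) \<Rightarrow> 'v set \<Rightarrow> 'v \<Rightarrow> 'v \<Rightarrow> 'v \<Rightarrow> 'a"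
  where "delta_form s N b =
    (\<lambda>x y. module.representation s N x b * module.representation s N y b)"

lemma bilinear_delta_form:
  assumes "finite_dimensional_vector_space s N"
  shows "bilinear_map s (*) (delta_form s N b)"
proof -
  interpret V: finite_dimensional_vector_space s N by (rule assms)
  have "V.representation N (x + y) b = V.representation N x b + V.representation N y b" for x y
    by (simp add: V.representation_add V.independent_Basis V.span_Basis)
  moreover have "V.representation N (s c x) b = c * V.representation N x b" for c x
    by (simp add: V.representation_scale V.independent_Basis V.span_Basis)
  ultimately show ?thesis
    unfolding bilinear_map_def delta_form_def
    by (auto intro!: Vector_Spaces.linear.intro module_hom.intro module_hom_axioms.intro
        V.vector_space_axioms V.module_axioms
        vector_space_over_itself.vector_space_axioms vector_space_over_itself.module_axioms
        simp: algebra_simps)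
qed

lemma delta_form_basis:
  assumes "finite_dimensional_vector_space s N" "b \<in> N" "x \<in> N" "y \<in> N"
  shows "delta_form s N b x y = (if x = b \<and> y = b then 1 else 0)"
proof -
  interpret V: finite_dimensional_vector_space s N by (rule assms)
  show ?thesis
    using assms by (simp add: delta_form_def V.representation_basis V.independent_Basis)
qed


text \<open>
  The quotient of a subspace \<open>V\<close> by a subspace \<open>W \<subseteq> V\<close>, as a set of cosets. Addition of cosets
  is elementwise addition of sets, the coset \<open>W\<close> is the zero, and \<open>coset_scale s W c C\<close> is the
  coset of \<open>c x\<close> for any \<open>x\<close> in \<open>C\<close>; adding \<open>W\<close> matters only for \<open>c = 0\<close>.
\<close>

definition quotient_space :: "'v::ab_group_add set \<Rightarrow> 'v set \<Rightarrow> 'v set set"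
  where "quotient_space V W = (\<lambda>x. x +o W) ` V"

definition coset_scale ::
  "('a::field \<Rightarrow> 'v::ab_group_add \<Rightarrow> 'v) \<Rightarrow> 'v set \<Rightarrow> 'a \<Rightarrow> 'v set \<Rightarrow> 'v set"
  where "coset_scale s W c C = s c ` C + W"

definition quotient_subspace ::
  "('a::field \<Rightarrow> 'v::ab_group_add \<Rightarrow> 'v) \<Rightarrow> 'v set \<Rightarrow> 'v set \<Rightarrow> 'v set set \<Rightarrow> bool"
  where "quotient_subspace s V W U \<longleftrightarrow>
    U \<subseteq> quotient_space V W \<and> W \<in> U \<and> (\<forall>C\<in>U. \<forall>D\<in>U. C + D \<in> U) \<and>
    (\<forall>c. \<forall>C\<in>U. coset_scale s W c C \<in> U)"

definition quotient_span ::
  "('a::field \<Rightarrow> 'v::ab_group_add \<Rightarrow> 'v) \<Rightarrow> 'v set \<Rightarrow> 'v set \<Rightarrow> 'v set set \<Rightarrow> 'v set set"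
  where "quotient_span s V W S = quotient_subspace s V W hull S"

definition H_space ::
  "('a::field \<Rightarrow> 'v::ab_group_add \<Rightarrow> 'v) \<Rightarrow> ('v \<Rightarrow> 'v \<Rightarrow> 'v) \<Rightarrow> 'v set \<Rightarrow> ('v \<Rightarrow> 'v \<Rightarrow> 'a) set set"
  where "H_space s m N = quotient_space (Z_forms s N) (B_forms s m)"

definition H_span ::
  "('a::field \<Rightarrow> 'v::ab_group_add \<Rightarrow> 'v) \<Rightarrow> ('v \<Rightarrow> 'v \<Rightarrow> 'v) \<Rightarrow> 'v set \<Rightarrow>
   ('v \<Rightarrow> 'v \<Rightarrow> 'a) set \<Rightarrow> ('v \<Rightarrow> 'v \<Rightarrow> 'a) set set"
  where "H_span s m N S =
    quotient_span form_scale (Z_forms s N) (B_forms s m) ((\<lambda>\<theta>. \<theta> +o B_forms s m) ` S)"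


text \<open>The bilinear product on coordinate space with \<open>e\<^sub>i e\<^sub>i = q i\<close> and \<open>e\<^sub>i e\<^sub>j = 0\<close> for \<open>i \<noteq> j\<close>.\<close>

definition evolution_product :: "('n::finite \<Rightarrow> 'a::field^'n) \<Rightarrow> 'a^'n \<Rightarrow> 'a^'n \<Rightarrow> 'a^'n"
  where "evolution_product q x y = (\<Sum>i\<in>UNIV. (x $ i * y $ i) *s q i)"

lemma evolution_product_axis:
  "evolution_product q (axis i 1) (axis j 1) = (if i = j then q i else 0)"
proof -
  have "evolution_product q (axis i 1) (axis j 1) =
      (\<Sum>k\<in>UNIV. if k = i then (if i = j then q i else 0) else 0)"
    unfolding evolution_product_def by (intro sum.cong) (auto simp: axis_def)
  then show ?thesis by simp
qed

end

theory Submission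
  imports Defs
begin

text \<open>
  An evolution algebra is determined by the squares of a natural basis, since all mixed products
  vanish (\<open>bilinear_map_diagonal\<close>, \<open>algebra_iso_coordinates\<close>). The classification in dimension
  two therefore only has to find a natural basis \<open>{u, v}\<close> whose squares are simple.

  Nilpotency enters through one principle: no right multiplication has a nonzero eigenvalue, because
  an eigenvector would survive in all powers (\<open>nilpotent_no_eigenvector\<close>). Applied to the squares
  \<open>u u\<close> and \<open>v v\<close> themselves, it gives \<open>u u = b v\<close> and \<open>v v = c u\<close>; applied to \<open>u + v\<close>, which
  right multiplication by \<open>c u + b v\<close> scales by \<open>b c\<close>, it gives \<open>b c = 0\<close>. So at least one square
  vanishes. If both do, all products are zero; if only \<open>u u = b v\<close> is nonzero, replacing \<open>v\<close> by
  \<open>b v\<close> yields the algebra with \<open>e\<^sub>1\<^sup>2 = e\<^sub>2\<close>. This uses no square roots and no restriction on the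
  characteristic. The two models differ because only one of them has a nonzero product.

  For the form spaces, the same diagonal expansion shows that the forms \<open>\<delta>\<^sub>b\<^sub>,\<^sub>b\<close> span \<open>Z_forms\<close>
  (\<open>Z_forms_eq_span\<close>), so the quotient by \<open>B_forms\<close> is generated by the classes of those \<open>\<delta>\<^sub>b\<^sub>,\<^sub>b\<close>
  that are not in \<open>B_forms\<close> (\<open>H_space_eq_H_span\<close>). For \<open>e\<^sub>1\<^sup>2 = e\<^sub>2\<close> the formula
  \<open>x y = x\<^sub>1 y\<^sub>1 e\<^sub>2\<close> gives everything else: a form \<open>f (x y)\<close> equals \<open>f e\<^sub>2\<close> times the first
  \<open>\<delta>\<close> form, an element annihilates iff its first coordinate is zero, and an automorphism is
  determined by the image of \<open>e\<^sub>1\<close>, as \<open>e\<^sub>2\<close> is its square.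
\<close>

section \<open>Evolution algebras in coordinates\<close>

lemma linear_at_zero:
  assumes "Vector_Spaces.linear s t f"
  shows "f 0 = 0"
proof -
  interpret Vector_Spaces.linear s t f by (rule assms)
  show ?thesis by simp
qed

text \<open>
  Orthogonality kills every mixed term of the double expansion over the basis. The product of an
  evolution algebra is such a map and so is every form in \<open>Z_forms\<close>, so this one expansion serves
  both the structure of the algebras and the computation of the form spaces.
\<close>

lemma bilinear_map_diagonal:
  assumes N: "finite_dimensional_vector_space s N" and \<beta>: "bilinear_map s t \<beta>"
    and off: "\<And>b c. b \<in> N \<Longrightarrow> c \<in> N \<Longrightarrow> b \<noteq> c \<Longrightarrow> \<beta> b c = 0"
  shows "\<beta> x y = (\<Sum>b\<in>N. t (module.representation s N x b * module.representation s N y b) (\<beta> b b))"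
proof -
  interpret V: finite_dimensional_vector_space s N by (rule N)
  interpret L: Vector_Spaces.linear s t "\<lambda>x. \<beta> x z" for z
    using \<beta> by (simp add: bilinear_map_def)
  interpret R: Vector_Spaces.linear s t "\<lambda>x. \<beta> z x" for z
    using \<beta> by (simp add: bilinear_map_def)
  let ?r = "V.representation N"
  have ex: "(\<Sum>b\<in>N. s (?r z b) b) = z" for z
    by (rule V.sum_representation_eq)
      (auto simp: V.independent_Basis V.span_Basis V.finite_Basis)
  have right: "\<beta> b y = t (?r y b) (\<beta> b b)" if "b \<in> N" for b
  proof -
    have "\<beta> b y = (\<Sum>c\<in>N. t (?r y c) (\<beta> b c))"
      by (subst ex[of y, symmetric]) (simp only: R.sum R.scale)
    also have "\<dots> = (\<Sum>c\<in>N. if c = b then t (?r y b) (\<beta> b b) else 0)"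
      using that off by (intro sum.cong) auto
    finally show ?thesis using that by (simp add: V.finite_Basis)
  qed
  have "\<beta> x y = (\<Sum>b\<in>N. t (?r x b) (\<beta> b y))"
    by (subst ex[of x, symmetric]) (simp only: L.sum L.scale)
  also have "\<dots> = (\<Sum>b\<in>N. t (?r x b * ?r y b) (\<beta> b b))"
    by (rule sum.cong[OF refl]) (simp add: right L.vs2.scale_scale)
  finally show ?thesis .
qed

text \<open>
  The product is determined by the squares of the natural basis vectors, so passing to coordinates
  identifies every evolution algebra with a coordinate model. Classification thereby reduces to
  choosing a natural basis whose squares look simple.
\<close>

lemma algebra_iso_coordinates:
  fixes g :: "'n::finite \<Rightarrow> 'v::ab_group_add" and s :: "'a::field \<Rightarrow> 'v \<Rightarrow> 'v"
  assumes m: "bilinear_map s s m" and N: "natural_basis s m (range g)" and g: "inj g"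
  defines "coords \<equiv> \<lambda>x. \<chi> i. module.representation s (range g) x (g i)"
  shows "algebra_iso s m (*s) (evolution_product (\<lambda>i. coords (m (g i) (g i)))) coords"
proof -
  let ?N = "range g"
  interpret V: finite_dimensional_vector_space s ?N
    using N by (simp add: natural_basis_def)
  let ?r = "V.representation ?N"
  note basis = V.independent_Basis V.span_Basis
  have lin: "Vector_Spaces.linear s (*s) coords"
    by (auto simp: Vector_Spaces.linear_iff V.vector_space_axioms vec.vector_space_axioms
        coords_def vec_eq_iff V.representation_add V.representation_scale basis)
  then interpret C: Vector_Spaces.linear s "(*s)" coords .
  have ex: "(\<Sum>i\<in>UNIV. s (?r x (g i)) (g i)) = x" for x
    using V.sum_representation_eq[of ?N x ?N] basis V.finite_Basis
    by (simp add: sum.reindex[OF g])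
  have unit: "coords (g i) = axis i 1" for i
    using V.representation_basis[OF V.independent_Basis, of "g i"] g
    by (auto simp: coords_def vec_eq_iff axis_def inj_eq)
  have "bij coords"
  proof (rule o_bij)
    show "(\<lambda>y. \<Sum>i\<in>UNIV. s (y $ i) (g i)) \<circ> coords = id"
      by (simp add: fun_eq_iff coords_def ex)
    show "coords \<circ> (\<lambda>y. \<Sum>i\<in>UNIV. s (y $ i) (g i)) = id"
      by (simp add: fun_eq_iff C.sum C.scale unit basis_expansion)
  qed
  moreover have "coords (m x y) = evolution_product (\<lambda>i. coords (m (g i) (g i))) (coords x) (coords y)"
    for x y
  proof -
    have "m x y = (\<Sum>i\<in>UNIV. s (?r x (g i) * ?r y (g i)) (m (g i) (g i)))"
      using bilinear_map_diagonal[OF V.finite_dimensional_vector_space_axioms m, of x y] N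
      by (simp add: natural_basis_def sum.reindex[OF g] Ball_def)
    then have "coords (m x y) = (\<Sum>i\<in>UNIV. (?r x (g i) * ?r y (g i)) *s coords (m (g i) (g i)))"
      by (simp only: C.sum C.scale)
    then show ?thesis
      by (simp add: evolution_product_def) (simp add: coords_def)
  qed
  ultimately show ?thesis
    using lin unfolding algebra_iso_def by blast
qed

text \<open>
  An equation \<open>x y = c x\<close> with \<open>c \<noteq> 0\<close> gives \<open>x = (1/c) (x y)\<close>, which keeps \<open>x\<close> in every right
  power of the algebra. All uses of nilpotency in the classification go through this lemma.
\<close>

lemma nilpotent_no_eigenvector:
  assumes m: "bilinear_map s s m" and nil: "nilpotent_algebra s m"
    and eigen: "m x y = s c x" and c: "c \<noteq> 0"
  shows "x = 0"
proof -
  interpret Vector_Spaces.linear s s "\<lambda>x. m x y"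
    using m by (simp add: bilinear_map_def)
  have "x \<in> right_power s m k" for k
  proof (induction k)
    case (Suc k)
    show ?case
    proof (cases k)
      case (Suc j)
      have "s (inverse c) (m x y) \<in> right_power s m (Suc k)"
        unfolding \<open>k = Suc j\<close> right_power.simps
        using Suc.IH \<open>k = Suc j\<close> by (intro vs1.span_scale vs1.span_base) auto
      then show ?thesis
        using c by (simp add: eigen del: right_power.simps)
    qed simp
  qed simp
  with nil show ?thesis
    by (auto simp: nilpotent_algebra_def)
qed

section \<open>Spans in quotient spaces\<close>

lemma (in vector_space) coset_add:
  assumes "subspace W"
  shows "(x +o W) + (y +o W) = (x + y) +o W"
proof -
  have "W + W = W"
    using assms by (force simp: set_plus_def subspace_def intro: exI[of _ 0])
  then show ?thesis
    by (simp add: set_plus_rearrange)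
qed

lemma (in vector_space) coset_scale_coset:
  assumes W: "subspace W"
  shows "coset_scale scale W c (x +o W) = scale c x +o W"
proof (rule set_eqI, rule iffI)
  fix z assume "z \<in> coset_scale scale W c (x +o W)"
  then obtain v w where "v \<in> W" "w \<in> W" "z = scale c (x + v) + w"
    by (auto simp: coset_scale_def elt_set_plus_def set_plus_def)
  then have "z = scale c x + (scale c v + w)" "scale c v + w \<in> W"
    using W by (auto simp: scale_right_distrib subspace_def)
  then show "z \<in> scale c x +o W" by (auto simp: elt_set_plus_def)
next
  fix z assume "z \<in> scale c x +o W"
  then obtain w where "w \<in> W" "z = scale c (x + 0) + w" by (auto simp: elt_set_plus_def)
  moreover have "0 \<in> W" using W by (simp add: subspace_0)
  ultimately show "z \<in> coset_scale scale W c (x +o W)"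
    unfolding coset_scale_def elt_set_plus_def set_plus_def by blast
qed

text \<open>
  For a subspace of the quotient, the vectors whose cosets it contains form a subspace upstairs.
  If the cosets of \<open>T\<close> lie in it, then \<open>T\<close> and \<open>W\<close> lie upstairs, and hence so does all of \<open>V\<close>.
  Spanning in the quotient is thus checked in the original space.
\<close>

lemma (in vector_space) quotient_span_eq:
  assumes V: "subspace V" and W: "subspace W" and sub: "W \<subseteq> V" "T \<subseteq> V"
    and gen: "V \<subseteq> span (T \<union> W)"
  shows "quotient_span scale V W ((\<lambda>x. x +o W) ` T) = quotient_space V W"
proof
  have zero: "w +o W = W" if "w \<in> W" for w
  proof -
    have "z \<in> w +o W" if "z \<in> W" for z
      using that \<open>w \<in> W\<close> W by (auto simp: elt_set_plus_def intro!: bexI[of _ "z - w"] subspace_diff)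
    then show ?thesis using that W by (auto simp: elt_set_plus_def subspace_add)
  qed
  note ops = coset_add[OF W] coset_scale_coset[OF W]
  have "quotient_subspace scale V W (quotient_space V W)"
    unfolding quotient_subspace_def
  proof (intro conjI ballI allI)
    show "W \<in> quotient_space V W"
      using zero[of 0] V W by (auto simp: quotient_space_def subspace_0 intro!: image_eqI[of _ _ 0])
  qed (use V in \<open>auto simp: quotient_space_def ops subspace_def\<close>)
  then show "quotient_span scale V W ((\<lambda>x. x +o W) ` T) \<subseteq> quotient_space V W"
    unfolding quotient_span_def using sub by (intro hull_minimal) (auto simp: quotient_space_def)
  \<comment> \<open>The hull is an intersection, so it suffices to treat one quotient subspace \<open>U\<close> at a time.\<close>
  show "quotient_space V W \<subseteq> quotient_span scale V W ((\<lambda>x. x +o W) ` T)"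
    unfolding quotient_span_def hull_def
  proof (rule Inter_greatest)
    fix U assume "U \<in> {U. quotient_subspace scale V W U \<and> (\<lambda>x. x +o W) ` T \<subseteq> U}"
    then have U: "quotient_subspace scale V W U" and T: "(\<lambda>x. x +o W) ` T \<subseteq> U" by auto
    have "subspace {x. x +o W \<in> U}"
    proof (rule subspaceI)
      show "0 \<in> {x. x +o W \<in> U}"
        using U zero[of 0] W by (simp add: quotient_subspace_def subspace_0)
    next
      fix x y assume "x \<in> {x. x +o W \<in> U}" "y \<in> {x. x +o W \<in> U}"
      then have "(x +o W) + (y +o W) \<in> U" using U by (simp add: quotient_subspace_def)
      then show "x + y \<in> {x. x +o W \<in> U}" by (simp add: ops)
    next
      fix c x assume "x \<in> {x. x +o W \<in> U}"
      then have "coset_scale scale W c (x +o W) \<in> U" using U by (simp add: quotient_subspace_def)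
      then show "scale c x \<in> {x. x +o W \<in> U}" by (simp add: ops)
    qed
    moreover have "T \<union> W \<subseteq> {x. x +o W \<in> U}"
      using T U zero by (auto simp: quotient_subspace_def)
    ultimately have "span (T \<union> W) \<subseteq> {x. x +o W \<in> U}" by (intro span_minimal)
    then show "quotient_space V W \<subseteq> U" using gen by (auto simp: quotient_space_def)
  qed
qed

section \<open>Diagonal forms\<close>

lemma sum_fun_apply2: "(\<Sum>b\<in>A. F b) x y = (\<Sum>b\<in>A. F b x y)"
  by (induction A rule: infinite_finite_induct) auto

lemma diagonal_form_eq_sum_delta:
  assumes N: "finite_dimensional_vector_space s N" and \<theta>: "\<theta> \<in> Z_forms s N"
  shows "\<theta> = (\<Sum>b\<in>N. form_scale (\<theta> b b) (delta_form s N b))"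
proof (intro ext)
  fix x y
  have "\<theta> x y = (\<Sum>b\<in>N. form_scale (\<theta> b b) (delta_form s N b) x y)"
    using \<theta> by (subst bilinear_map_diagonal[OF N, of "(*)"])
      (auto simp: Z_forms_def form_scale_def delta_form_def mult.commute)
  also have "\<dots> = (\<Sum>b\<in>N. form_scale (\<theta> b b) (delta_form s N b)) x y"
    by (rule sum_fun_apply2[symmetric])
  finally show "\<theta> x y = (\<Sum>b\<in>N. form_scale (\<theta> b b) (delta_form s N b)) x y" .
qed

lemma subspace_Z_forms:
  assumes "vector_space s" shows "forms.subspace (Z_forms s N)"
proof (rule forms.subspaceI)
qed (use assms in \<open>auto simp: Z_forms_def bilinear_map_def Vector_Spaces.linear_iff
   vector_space_over_itself.vector_space_axioms form_scale_def algebra_simps\<close>)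

lemma delta_form_in_Z_forms:
  assumes "finite_dimensional_vector_space s N" "b \<in> N"
  shows "delta_form s N b \<in> Z_forms s N"
  using assms by (auto simp: Z_forms_def bilinear_delta_form delta_form_basis)

text \<open>
  The diagonal expansion of a form has the values \<open>\<theta> b b\<close> as coefficients of the \<open>delta\<close> forms.
\<close>

lemma Z_forms_eq_span:
  assumes N: "finite_dimensional_vector_space s N"
  shows "Z_forms s N = forms.span (delta_form s N ` N)"
proof
  show "Z_forms s N \<subseteq> forms.span (delta_form s N ` N)"
  proof
    fix \<theta> assume "\<theta> \<in> Z_forms s N"
    then show "\<theta> \<in> forms.span (delta_form s N ` N)"
      by (subst diagonal_form_eq_sum_delta[OF N]) (auto intro!: forms.span_sum forms.span_scale intro: forms.span_base)
  qed
  show "forms.span (delta_form s N ` N) \<subseteq> Z_forms s N"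
    using N delta_form_in_Z_forms[OF N]
    by (intro forms.span_minimal subspace_Z_forms) (auto simp: finite_dimensional_vector_space_def)
qed

lemma subspace_B_forms:
  assumes "vector_space s" shows "forms.subspace (B_forms s m)"
proof (rule forms.subspaceI)
  let ?L = "Vector_Spaces.linear s (*)"
  have L: "?L f \<longleftrightarrow> (\<forall>x y. f (x + y) = f x + f y) \<and> (\<forall>c x. f (s c x) = c * f x)" for f
    using assms by (simp add: Vector_Spaces.linear_iff vector_space_over_itself.vector_space_axioms)
  show "0 \<in> B_forms s m"
    unfolding B_forms_def mem_Collect_eq by (rule exI[of _ "\<lambda>_. 0"]) (simp add: L fun_eq_iff)
  fix \<theta> assume "\<theta> \<in> B_forms s m"
  then obtain f where f: "?L f" "\<theta> = (\<lambda>x y. f (m x y))" by (auto simp: B_forms_def)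
  show "form_scale c \<theta> \<in> B_forms s m" for c
    unfolding B_forms_def mem_Collect_eq
    by (rule exI[of _ "\<lambda>x. c * f x"]) (use f in \<open>simp add: L fun_eq_iff form_scale_def algebra_simps\<close>)
  fix \<eta> assume "\<eta> \<in> B_forms s m"
  then obtain h where h: "?L h" "\<eta> = (\<lambda>x y. h (m x y))" by (auto simp: B_forms_def)
  show "\<theta> + \<eta> \<in> B_forms s m"
    unfolding B_forms_def mem_Collect_eq
    by (rule exI[of _ "\<lambda>x. f x + h x"]) (use f h in \<open>simp add: L fun_eq_iff algebra_simps\<close>)
qed

lemma B_forms_subset_Z_forms:
  assumes m: "bilinear_map s s m" and N: "natural_basis s m N"
  shows "B_forms s m \<subseteq> Z_forms s N"
  using m N by (auto simp: linear_at_zero B_forms_def Z_forms_def bilinear_map_def natural_basis_def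
        Vector_Spaces.linear_iff)

text \<open>
  The \<open>delta\<close> forms span \<open>Z_forms\<close>, and those already in \<open>B_forms\<close> vanish in the quotient,
  so the classes of the others generate it.
\<close>

lemma H_space_eq_H_span:
  assumes m: "bilinear_map s s m" and N: "natural_basis s m N" and S: "S \<subseteq> N"
    and B: "\<And>b. b \<in> N - S \<Longrightarrow> delta_form s N b \<in> B_forms s m"
  shows "H_space s m N = H_span s m N (delta_form s N ` S)"
proof -
  have N': "finite_dimensional_vector_space s N" using N by (simp add: natural_basis_def)
  then have s: "vector_space s" by (simp add: finite_dimensional_vector_space_def)
  have "Z_forms s N \<subseteq> forms.span (delta_form s N ` S \<union> B_forms s m)"
    unfolding Z_forms_eq_span[OF N'] using B by (intro forms.span_mono) auto
  then show ?thesis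
    unfolding H_space_def H_span_def
    using S delta_form_in_Z_forms[OF N']
    by (intro forms.quotient_span_eq[symmetric] subspace_Z_forms subspace_B_forms s
        B_forms_subset_Z_forms m N) auto
qed

section \<open>The coordinate model\<close>

lemma bilinear_evolution_product: "bilinear_map (*s) (*s) (evolution_product q)"
  by (auto simp: bilinear_map_def Vector_Spaces.linear_iff vec.vector_space_axioms
      evolution_product_def algebra_simps sum.distrib vec.scale_sum_right vec.scale_left_distrib)

lemma natural_basis_evolution_product:
  fixes q :: "'n::finite \<Rightarrow> 'a::field^'n"
  shows "natural_basis (*s) (evolution_product q) (range (\<lambda>i. axis i 1))"
proof -
  have "range (\<lambda>i. axis i 1) = (cart_basis :: ('a^'n) set)"
    by (auto simp: cart_basis_def)
  then have "finite_dimensional_vector_space (*s) (range (\<lambda>i. axis i 1) :: ('a^'n) set)"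
    using vec.finite_dimensional_vector_space_axioms by simp
  then show ?thesis
    by (auto simp: natural_basis_def evolution_product_axis)
qed

lemma representation_axis_basis:
  fixes x :: "'a::field^'n"
  shows "vec.representation (range (\<lambda>i. axis i 1)) x (axis i 1) = x $ i"
proof -
  have cart: "range (\<lambda>i. axis i 1) = (cart_basis :: ('a^'n) set)"
    by (auto simp: cart_basis_def)
  have "vec.representation cart_basis x (axis i 1) =
      (\<Sum>j\<in>UNIV. vec.representation cart_basis (x $ j *s axis j 1) (axis i 1))"
    by (subst basis_expansion[of x, symmetric])
      (simp only: vec.representation_sum[OF independent_cart_basis] span_cart_basis UNIV_I)
  also have "\<dots> = (\<Sum>j\<in>UNIV. if j = i then x $ i else 0)"
  proof (rule sum.cong[OF refl])
    fix j
    have "axis j 1 \<in> (cart_basis :: ('a^'n) set)" by (auto simp: cart_basis_def)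
    then show "vec.representation cart_basis (x $ j *s axis j 1) (axis i 1) = (if j = i then x $ i else 0)"
      by (simp add: vec.representation_scale independent_cart_basis vec.representation_basis axis_eq_axis)
  qed
  finally show ?thesis by (simp add: cart)
qed

section \<open>Nilpotent evolution algebras of dimension two\<close>

text \<open>
  In coordinates for \<open>{u, v}\<close> the squares become \<open>0, 0\<close> or \<open>e\<^sub>2, 0\<close>, which are the two models.
\<close>

lemma isomorphic_model_if_square_in_basis:
  fixes s :: "'a::field \<Rightarrow> 'v::ab_group_add \<Rightarrow> 'v"
  assumes m: "bilinear_map s s m" and N: "natural_basis s m {u, v}" and "u \<noteq> v" and vv: "m v v = 0"
  shows "m u u = 0 \<Longrightarrow> isomorphic_algebras s m (*s) (evolution_product (\<lambda>i::2. 0))"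
    and "m u u = v \<Longrightarrow>
      isomorphic_algebras s m (*s) (evolution_product (\<lambda>i::2. if i = 1 then axis 2 1 else 0))"
proof -
  define g :: "2 \<Rightarrow> 'v" where "g i = (if i = 1 then u else v)" for i
  have g: "inj g" and ran: "range g = {u, v}"
    using \<open>u \<noteq> v\<close> exhaust_2 by (auto simp: inj_def g_def UNIV_2)
  interpret V: finite_dimensional_vector_space s "{u, v}"
    using N by (simp add: natural_basis_def)
  let ?c = "\<lambda>x. \<chi> i. V.representation {u, v} x (g i)"
  have iso: "isomorphic_algebras s m (*s) (evolution_product (\<lambda>i. ?c (m (g i) (g i))))"
    using algebra_iso_coordinates[OF m _ g] N unfolding ran isomorphic_algebras_def by blast
  have zero: "?c 0 = 0"
    by (simp add: vec_eq_iff V.representation_zero)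
  have v: "?c v = axis 2 1"
    using \<open>u \<noteq> v\<close> by (auto simp: vec_eq_iff forall_2 g_def axis_def
        V.representation_basis V.independent_Basis)
  show "isomorphic_algebras s m (*s) (evolution_product (\<lambda>i::2. 0))" if "m u u = 0"
  proof -
    have "(\<lambda>i. ?c (m (g i) (g i))) = (\<lambda>i. 0)"
      using that zero vv by (simp add: fun_eq_iff g_def)
    then show ?thesis using iso by simp
  qed
  show "isomorphic_algebras s m (*s) (evolution_product (\<lambda>i::2. if i = 1 then axis 2 1 else 0))"
    if "m u u = v"
  proof -
    have "(\<lambda>i. ?c (m (g i) (g i))) = (\<lambda>i. if i = 1 then axis 2 1 else 0)"
      using that zero v vv by (simp add: fun_eq_iff g_def)
    then show ?thesis using iso by simp
  qed
qed

text \<open>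
  If \<open>b \<noteq> 0\<close>, then \<open>{u, b v}\<close> is again a natural basis, and the square of its first vector is
  now its second vector: the structure constant \<open>b\<close> can be scaled away over any field.
\<close>

lemma isomorphic_model_if_one_square_zero:
  fixes s :: "'a::field \<Rightarrow> 'v::ab_group_add \<Rightarrow> 'v"
  assumes m: "bilinear_map s s m" and N: "natural_basis s m {u, v}" and uv: "u \<noteq> v"
    and uu: "m u u = s b v" and vv: "m v v = 0"
  shows "isomorphic_algebras s m (*s) (evolution_product (\<lambda>i::2. 0)) \<or>
    isomorphic_algebras s m (*s) (evolution_product (\<lambda>i::2. if i = 1 then axis 2 1 else 0))"
proof -
  interpret V: finite_dimensional_vector_space s "{u, v}"
    using N by (simp add: natural_basis_def)
  interpret R: Vector_Spaces.linear s s "m z" for z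
    using m by (simp add: bilinear_map_def)
  interpret L: Vector_Spaces.linear s s "\<lambda>x. m x z" for z
    using m by (simp add: bilinear_map_def)
  let ?w = "s b v"
  show ?thesis
  proof (cases "b = 0")
    case True
    then show ?thesis using isomorphic_model_if_square_in_basis(1)[OF m N uv vv] uu by simp
  next
    case False
    have u: "u \<notin> V.span {v}"
      using V.independent_Basis uv by (simp add: V.independent_insert)
    have "v = s (inverse b) ?w" using False by simp
    then have "v \<in> V.span {?w}"
      by (metis V.span_base V.span_scale insertI1)
    moreover have "?w \<in> V.span {v}" by (intro V.span_scale V.span_base) simp
    ultimately have span: "V.span {?w} = V.span {v}"
      by (intro V.span_eq[THEN iffD2]) simp
    have "?w \<noteq> 0"
      using False V.dependent_zero[of "{u, v}"] V.independent_Basis by auto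
    then have "V.independent {u, ?w}"
      using u span by (simp add: V.independent_insert)
    moreover have "V.span {u, ?w} = UNIV"
      using V.span_Basis span by (simp add: V.span_insert)
    ultimately have "finite_dimensional_vector_space s {u, ?w}"
      by unfold_locales auto
    then have "natural_basis s m {u, ?w}"
      using N uv by (auto simp: natural_basis_def R.scale L.scale)
    moreover have "u \<noteq> ?w" using u span V.span_base by blast
    moreover have "m ?w ?w = 0" by (simp add: R.scale L.scale vv)
    ultimately show ?thesis using isomorphic_model_if_square_in_basis(2)[OF m] uu by blast
  qed
qed

text \<open>
  Right multiplications have no nonzero eigenvalue, which is used twice for a natural basis
  \<open>{u, v}\<close>. First, if \<open>u u = a u + b v\<close> then \<open>(u u) u = a (u u)\<close>, so \<open>u u\<close> is a multiple of
  \<open>v\<close>, and likewise \<open>v v\<close> of \<open>u\<close>. Second, with \<open>u u = b v\<close> and \<open>v v = c u\<close> the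
  vector \<open>u + v\<close> is an eigenvector for the value \<open>b c\<close>, so one of the squares is zero.
\<close>

lemma nilpotent_evolution_algebra_dim_2:
  fixes s :: "'a::field \<Rightarrow> 'v::ab_group_add \<Rightarrow> 'v"
  assumes ev: "evolution_algebra s m" and nil: "nilpotent_algebra s m"
    and dim: "vector_space.dim s (UNIV :: 'v set) = 2"
  shows "isomorphic_algebras s m (*s) (evolution_product (\<lambda>i::2. 0)) \<or>
    isomorphic_algebras s m (*s) (evolution_product (\<lambda>i::2. if i = 1 then axis 2 1 else 0))"
proof -
  obtain N where m: "bilinear_map s s m" and N: "natural_basis s m N"
    using ev unfolding evolution_algebra_def by blast
  interpret V: finite_dimensional_vector_space s N
    using N by (simp add: natural_basis_def)
  interpret R: Vector_Spaces.linear s s "m z" for z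
    using m by (simp add: bilinear_map_def)
  interpret L: Vector_Spaces.linear s s "\<lambda>x. m x z" for z
    using m by (simp add: bilinear_map_def)
  have "card N = 2"
    using dim V.dim_UNIV by (simp add: V.dimension_def)
  then obtain u v where Nuv: "N = {u, v}" and uv: "u \<noteq> v"
    by (auto simp: card_2_iff)
  have orth: "m u v = 0" "m v u = 0"
    using N uv by (auto simp: natural_basis_def Nuv)
  have coords: "\<exists>a b. x = s a u + s b v" for x
  proof -
    have "x \<in> V.span {u, v}" using V.span_Basis by (simp add: Nuv)
    then obtain a where "x - s a u \<in> V.span {v}" by (auto simp: V.span_insert)
    then obtain b where "x - s a u = s b v" by (auto simp: V.span_singleton)
    then show ?thesis by (metis add.commute diff_add_cancel)
  qed
  have square: "\<exists>b. m x x = s b y"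
    if xy: "m y x = 0" and gen: "\<exists>a b. m x x = s a x + s b y" for x y
  proof -
    from gen obtain a b where ab: "m x x = s a x + s b y" by blast
    then have "m (m x x) x = s a (m x x)"
      by (simp add: L.add L.scale xy)
    then have "a = 0 \<or> m x x = 0"
      using nilpotent_no_eigenvector[OF m nil] by blast
    then show ?thesis
      using ab by (metis V.scale_zero_left add_0)
  qed
  obtain b where b: "m u u = s b v" using square[OF orth(2) coords] by blast
  obtain c where c: "m v v = s c u"
    using square[of u v] orth coords by (metis add.commute)
  \<comment> \<open>The factor \<open>c u + b v\<close> is chosen so that \<open>u\<close> and \<open>v\<close> both get the coefficient \<open>b c\<close>.\<close>
  have "m (u + v) (s c u + s b v) = s (b * c) (u + v)"
    by (simp add: R.add R.scale L.add L.scale orth b c V.scale_right_distrib mult.commute add.commute)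
  moreover have "u + v \<noteq> 0"
  proof
    assume "u + v = 0"
    then have "u = s (- 1) v" by (simp add: eq_neg_iff_add_eq_0)
    then have "u \<in> V.span {v}" by (metis V.span_base V.span_scale singletonI)
    then show False using V.independent_Basis uv by (simp add: Nuv V.independent_insert)
  qed
  ultimately have "b * c = 0"
    using nilpotent_no_eigenvector[OF m nil] by blast
  then consider "c = 0" | "b = 0" by auto
  then show ?thesis
  proof cases
    case 1
    then show ?thesis
      using isomorphic_model_if_one_square_zero[OF m N[unfolded Nuv] uv b] c by simp
  next
    case 2
    have "natural_basis s m {v, u}" using N by (simp add: Nuv insert_commute)
    then show ?thesis
      using isomorphic_model_if_one_square_zero[OF m _ uv[symmetric] c] b 2 by simp
  qed
qed

section \<open>The two models\<close>

lemma evolution_product_zero: "evolution_product (\<lambda>i. 0) x y = 0"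
  by (simp add: evolution_product_def)

lemma evolution_product_shift:
  fixes x y :: "'a::field^2"
  shows "evolution_product (\<lambda>i. if i = 1 then axis 2 1 else 0) x y = (x $ 1 * y $ 1) *s axis 2 1"
  by (simp add: evolution_product_def sum_2)

lemma range_axis_2: "range (\<lambda>i::2. axis i 1) = {axis 1 1, axis 2 1}"
  by (simp add: UNIV_2)

lemma delta_form_axis:
  fixes x y :: "'a::field^'n"
  shows "delta_form (*s) (range (\<lambda>i. axis i 1)) (axis i 1) x y = x $ i * y $ i"
  by (simp add: delta_form_def representation_axis_basis)

lemma evolution_algebra_evolution_product:
  "evolution_algebra (*s) (evolution_product (q :: 'n::finite \<Rightarrow> 'a::field^'n))"
  using bilinear_evolution_product natural_basis_evolution_product
  unfolding evolution_algebra_def by blast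

lemma nilpotent_zero: "nilpotent_algebra (*s) (evolution_product (\<lambda>i. 0 :: 'a::field^'n))"
proof -
  have "right_power (*s) (evolution_product (\<lambda>i. 0 :: 'a^'n)) 2 \<subseteq> {0}"
    unfolding numeral_2_eq_2 right_power.simps
    by (rule vec.span_minimal) (auto simp: evolution_product_zero)
  moreover have "0 \<in> right_power (*s) (evolution_product (\<lambda>i. 0 :: 'a^'n)) 2"
    by (simp add: numeral_2_eq_2 vec.span_zero)
  ultimately show ?thesis
    unfolding nilpotent_algebra_def by (intro exI[of _ 2]) auto
qed

text \<open>
  The second power has first coordinates zero, and only first coordinates enter the product, so
  the third power is zero.
\<close>

lemma nilpotent_shift:
  "nilpotent_algebra (*s) (evolution_product (\<lambda>i::2. if i = 1 then axis 2 (1::'a::field) else 0))"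
proof -
  let ?m = "evolution_product (\<lambda>i::2. if i = 1 then axis 2 (1::'a) else 0)"
  have "vec.subspace {x :: 'a^2. x $ 1 = 0}"
    by (rule vec.subspaceI) auto
  then have 2: "right_power (*s) ?m (Suc (Suc 0)) \<subseteq> {x. x $ 1 = 0}"
    unfolding right_power.simps
    by (intro vec.span_minimal) (auto simp: evolution_product_shift axis_def)
  have "right_power (*s) ?m 3 \<subseteq> {0}"
    unfolding numeral_3_eq_3 right_power.simps(3)[of "(*s)" ?m "Suc 0"]
    using 2 by (intro vec.span_minimal) (auto simp: evolution_product_shift simp del: right_power.simps)
  moreover have "0 \<in> right_power (*s) ?m 3"
    by (simp add: numeral_3_eq_3 vec.span_zero)
  ultimately show ?thesis
    unfolding nilpotent_algebra_def by (intro exI[of _ 3]) auto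
qed

lemma B_forms_zero_product: "B_forms (*s) (evolution_product (\<lambda>i. 0 :: 'a::field^'n)) = {0}"
proof -
  have "Vector_Spaces.linear (*s) (*) (\<lambda>x :: 'a^'n. 0 :: 'a)"
    by (simp add: Vector_Spaces.linear_iff vec.vector_space_axioms vector_space_over_itself.vector_space_axioms)
  then show ?thesis
    by (auto simp: B_forms_def evolution_product_zero fun_eq_iff linear_at_zero)
qed

text \<open>
  Every product is a multiple of \<open>e\<^sub>2\<close>, so the form \<open>f (x y)\<close> depends only on \<open>f e\<^sub>2\<close>, which may
  be any scalar.
\<close>

lemma B_forms_shift:
  "B_forms (*s) (evolution_product (\<lambda>i::2. if i = 1 then axis 2 (1::'a::field) else 0)) =
    forms.span {delta_form (*s) (range (\<lambda>i. axis i 1)) (axis 1 1)}"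
    (is "?B = forms.span {?d}")
proof -
  have span: "forms.span {?d} = range (\<lambda>c. form_scale c ?d)"
    by (rule forms.span_singleton)
  have "(\<lambda>x y. f (evolution_product (\<lambda>i::2. if i = 1 then axis 2 (1::'a) else 0) x y)) =
      form_scale (f (axis 2 1)) ?d" if "Vector_Spaces.linear (*s) (*) f" for f :: "'a^2 \<Rightarrow> 'a"
  proof -
    interpret Vector_Spaces.linear "(*s)" "(*)" f by fact
    show ?thesis
      by (simp add: fun_eq_iff evolution_product_shift scale form_scale_def delta_form_axis)
  qed
  moreover have "form_scale c ?d \<in> ?B" for c
  proof -
    have "Vector_Spaces.linear (*s) (*) (\<lambda>x :: 'a^2. c * x $ 2)"
      by (simp add: Vector_Spaces.linear_iff vec.vector_space_axioms
          vector_space_over_itself.vector_space_axioms algebra_simps)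
    moreover have "form_scale c ?d =
        (\<lambda>x y. c * evolution_product (\<lambda>i::2. if i = 1 then axis 2 (1::'a) else 0) x y $ 2)"
      by (simp add: fun_eq_iff evolution_product_shift form_scale_def delta_form_axis)
    ultimately show ?thesis
      unfolding B_forms_def mem_Collect_eq by (intro exI[of _ "\<lambda>x. c * x $ 2"]) simp
  qed
  ultimately show ?thesis
    unfolding span by (auto simp: B_forms_def)
qed

lemma annihilator_shift:
  "annihilator (evolution_product (\<lambda>i::2. if i = 1 then axis 2 (1::'a::field) else 0)) =
    vec.span {axis 2 1}"
proof -
  have "annihilator (evolution_product (\<lambda>i::2. if i = 1 then axis 2 (1::'a) else 0)) = {x. x $ 1 = 0}"
  proof (intro set_eqI iffI)
    fix x :: "'a^2" assume "x \<in> annihilator (evolution_product (\<lambda>i. if i = 1 then axis 2 1 else 0))"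
    then have "(x $ 1 * axis 1 (1::'a) $ (1::2)) *s axis 2 (1::'a) = (0 :: 'a^2)"
      unfolding annihilator_def mem_Collect_eq evolution_product_shift by blast
    then have "((x $ 1 * axis 1 (1::'a) $ (1::2)) *s axis 2 (1::'a) :: 'a^2) $ 2 = 0" by simp
    then show "x \<in> {x. x $ 1 = 0}" by simp
  qed (auto simp: annihilator_def evolution_product_shift)
  also have "\<dots> = range (\<lambda>c. c *s axis 2 1)"
  proof (intro set_eqI iffI)
    fix x :: "'a^2" assume "x \<in> {x. x $ 1 = 0}"
    then have "x = x $ 2 *s axis 2 1"
      by (auto simp: vec_eq_iff forall_2 axis_def)
    then show "x \<in> range (\<lambda>c. c *s axis 2 1)" by blast
  qed (auto simp: axis_def)
  finally show ?thesis
    by (simp add: vec.span_singleton)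
qed

lemma algebra_auts_zero_product:
  "algebra_auts (*s) (evolution_product (\<lambda>i. 0 :: 'a::field^'n)) = general_linear_maps (*s)"
  by (auto simp: algebra_auts_def algebra_iso_def general_linear_maps_def evolution_product_zero
      linear_at_zero)

text \<open>
  Applying \<open>\<phi>\<close> to \<open>e\<^sub>1 e\<^sub>1 = e\<^sub>2\<close> forces \<open>\<phi> e\<^sub>2 = a\<^sup>2 e\<^sub>2\<close>, where \<open>a\<close> is the first coordinate of
  \<open>\<phi> e\<^sub>1\<close>; this is the second column of the matrix. Conversely, such a matrix multiplies first
  coordinates by \<open>a\<close> and \<open>e\<^sub>2\<close> by \<open>a\<^sup>2\<close>, so both sides of \<open>\<phi> (x y) = \<phi> x \<phi> y\<close> equal
  \<open>a\<^sup>2 x\<^sub>1 y\<^sub>1 e\<^sub>2\<close>.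
\<close>

lemma algebra_auts_shift:
  "algebra_auts (*s) (evolution_product (\<lambda>i::2. if i = 1 then axis 2 (1::'a::field) else 0)) =
    {\<phi> \<in> general_linear_maps (*s). \<exists>a b. matrix \<phi> = vector [vector [a, 0], vector [b, a\<^sup>2]]}"
    (is "algebra_auts (*s) ?m = _")
proof -
  have iff: "(\<forall>x y. \<phi> (?m x y) = ?m (\<phi> x) (\<phi> y)) \<longleftrightarrow>
      (\<exists>a b. matrix \<phi> = vector [vector [a, 0], vector [b, a\<^sup>2]])"
    if \<phi>: "Vector_Spaces.linear (*s) (*s) \<phi>" for \<phi> :: "'a^2 \<Rightarrow> 'a^2"
  proof
    interpret Vector_Spaces.linear "(*s)" "(*s)" \<phi> by fact
    assume mult: "\<forall>x y. \<phi> (?m x y) = ?m (\<phi> x) (\<phi> y)"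
    have "\<phi> (axis 2 1) = \<phi> (?m (axis 1 1) (axis 1 1))"
      by (simp add: evolution_product_axis)
    also have "\<dots> = (\<phi> (axis 1 1) $ 1)\<^sup>2 *s axis 2 1"
      using mult by (simp only: evolution_product_shift[of "\<phi> _"] power2_eq_square)
    finally have "matrix \<phi> = vector [vector [\<phi> (axis 1 1) $ 1, 0],
        vector [\<phi> (axis 1 1) $ 2, (\<phi> (axis 1 1) $ 1)\<^sup>2]]"
      by (simp add: matrix_def vec_eq_iff forall_2 axis_def)
    then show "\<exists>a b. matrix \<phi> = vector [vector [a, 0], vector [b, a\<^sup>2]]" by blast
  next
    assume "\<exists>a b. matrix \<phi> = vector [vector [a, 0], vector [b, a\<^sup>2]]"
    then obtain a b where M: "matrix \<phi> = vector [vector [a, 0], vector [b, a\<^sup>2]]" by blast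
    have "\<phi> x $ 1 = a * x $ 1" "\<phi> x $ 2 = b * x $ 1 + a\<^sup>2 * x $ 2" for x
      by (simp_all add: matrix_works[OF \<phi>, symmetric] M matrix_vector_mult_def sum_2)
    then show "\<forall>x y. \<phi> (?m x y) = ?m (\<phi> x) (\<phi> y)"
      by (simp add: vec_eq_iff forall_2 evolution_product_shift axis_def power2_eq_square)
  qed
  show ?thesis
    unfolding algebra_auts_def algebra_iso_def general_linear_maps_def using iff by blast
qed

lemma not_isomorphic_zero_shift:
  "\<not> isomorphic_algebras (*s) (evolution_product (\<lambda>i::2. 0 :: 'a::field^2))
    (*s) (evolution_product (\<lambda>i::2. if i = 1 then axis 2 (1::'a) else 0))"
proof
  assume "isomorphic_algebras (*s) (evolution_product (\<lambda>i::2. 0 :: 'a^2))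
    (*s) (evolution_product (\<lambda>i::2. if i = 1 then axis 2 (1::'a) else 0))"
  then obtain \<phi> :: "'a^2 \<Rightarrow> 'a^2" where lin: "Vector_Spaces.linear (*s) (*s) \<phi>" and "bij \<phi>"
    and mult: "\<And>x y. \<phi> 0 = evolution_product (\<lambda>i. if i = 1 then axis 2 1 else 0) (\<phi> x) (\<phi> y)"
    unfolding isomorphic_algebras_def algebra_iso_def by (auto simp: evolution_product_zero)
  interpret Vector_Spaces.linear "(*s)" "(*s)" \<phi> by fact
  obtain x where "\<phi> x = axis 1 1"
    using \<open>bij \<phi>\<close> by (metis bij_pointE)
  then have "axis 2 1 = (0 :: 'a^2)"
    using mult[of x x] by (simp add: evolution_product_axis)
  then show False by (simp add: axis_eq_0_iff)
qed

section \<open>The classification\<close>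

theorem theorem17:
  fixes e\<^sub>1 e\<^sub>2 :: "'a::field^2" and E\<^sub>2\<^sub>1 E\<^sub>2\<^sub>2 :: "'a^2 \<Rightarrow> 'a^2 \<Rightarrow> 'a^2"
  defines "e\<^sub>1 \<equiv> axis 1 1" and "e\<^sub>2 \<equiv> axis 2 1"
    and "E\<^sub>2\<^sub>1 \<equiv> evolution_product (\<lambda>i. 0)"
    and "E\<^sub>2\<^sub>2 \<equiv> evolution_product (\<lambda>i. if i = 1 then e\<^sub>2 else 0)"
  shows
    "(evolution_algebra (*s) E\<^sub>2\<^sub>1 \<and> nilpotent_algebra (*s) E\<^sub>2\<^sub>1 \<and> natural_basis (*s) E\<^sub>2\<^sub>1 {e\<^sub>1, e\<^sub>2}) \<and>
     (evolution_algebra (*s) E\<^sub>2\<^sub>2 \<and> nilpotent_algebra (*s) E\<^sub>2\<^sub>2 \<and> natural_basis (*s) E\<^sub>2\<^sub>2 {e\<^sub>1, e\<^sub>2}) \<and>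
     vec.dim (UNIV :: ('a^2) set) = 2 \<and>
     (\<forall>(s :: 'a \<Rightarrow> 'v::ab_group_add \<Rightarrow> 'v) m.
        evolution_algebra s m \<and> nilpotent_algebra s m \<and> vector_space.dim s (UNIV :: 'v set) = 2 \<longrightarrow>
        isomorphic_algebras s m (*s) E\<^sub>2\<^sub>1 \<or> isomorphic_algebras s m (*s) E\<^sub>2\<^sub>2) \<and>
     \<not> isomorphic_algebras (*s) E\<^sub>2\<^sub>1 (*s) E\<^sub>2\<^sub>2 \<and>

     B_forms (*s) E\<^sub>2\<^sub>1 = {0} \<and>
     H_space (*s) E\<^sub>2\<^sub>1 {e\<^sub>1, e\<^sub>2} =
       H_span (*s) E\<^sub>2\<^sub>1 {e\<^sub>1, e\<^sub>2} {delta_form (*s) {e\<^sub>1, e\<^sub>2} e\<^sub>1, delta_form (*s) {e\<^sub>1, e\<^sub>2} e\<^sub>2} \<and>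
     annihilator E\<^sub>2\<^sub>1 = UNIV \<and>
     algebra_auts (*s) E\<^sub>2\<^sub>1 = general_linear_maps (*s) \<and>

     B_forms (*s) E\<^sub>2\<^sub>2 = forms.span {delta_form (*s) {e\<^sub>1, e\<^sub>2} e\<^sub>1} \<and>
     H_space (*s) E\<^sub>2\<^sub>2 {e\<^sub>1, e\<^sub>2} =
       H_span (*s) E\<^sub>2\<^sub>2 {e\<^sub>1, e\<^sub>2} {delta_form (*s) {e\<^sub>1, e\<^sub>2} e\<^sub>2} \<and>
     annihilator E\<^sub>2\<^sub>2 = vec.span {e\<^sub>2} \<and>
     algebra_auts (*s) E\<^sub>2\<^sub>2 =
       {\<phi> \<in> general_linear_maps (*s).
          \<exists>a\<^sub>1\<^sub>1 a\<^sub>2\<^sub>1. matrix \<phi> = vector [vector [a\<^sub>1\<^sub>1, 0], vector [a\<^sub>2\<^sub>1, a\<^sub>1\<^sub>1\<^sup>2]]}"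
proof -
  have basis: "natural_basis (*s) (evolution_product q) {e\<^sub>1, e\<^sub>2}" for q :: "2 \<Rightarrow> 'a^2"
    using natural_basis_evolution_product[of q] by (simp add: range_axis_2 e\<^sub>1_def e\<^sub>2_def)
  have B2: "B_forms (*s) E\<^sub>2\<^sub>2 = forms.span {delta_form (*s) {e\<^sub>1, e\<^sub>2} e\<^sub>1}"
    using B_forms_shift[where 'a='a] unfolding E\<^sub>2\<^sub>2_def e\<^sub>1_def e\<^sub>2_def range_axis_2 .
  have H1: "H_space (*s) E\<^sub>2\<^sub>1 {e\<^sub>1, e\<^sub>2} =
      H_span (*s) E\<^sub>2\<^sub>1 {e\<^sub>1, e\<^sub>2} {delta_form (*s) {e\<^sub>1, e\<^sub>2} e\<^sub>1, delta_form (*s) {e\<^sub>1, e\<^sub>2} e\<^sub>2}"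
    using H_space_eq_H_span[OF bilinear_evolution_product basis, of "{e\<^sub>1, e\<^sub>2}" "\<lambda>i. 0"]
    by (simp add: E\<^sub>2\<^sub>1_def)
  have "delta_form (*s) {e\<^sub>1, e\<^sub>2} e\<^sub>1 \<in> B_forms (*s) E\<^sub>2\<^sub>2"
    unfolding B2 by (rule forms.span_base) simp
  then have H2: "H_space (*s) E\<^sub>2\<^sub>2 {e\<^sub>1, e\<^sub>2} =
      H_span (*s) E\<^sub>2\<^sub>2 {e\<^sub>1, e\<^sub>2} {delta_form (*s) {e\<^sub>1, e\<^sub>2} e\<^sub>2}"
    using H_space_eq_H_span[OF bilinear_evolution_product basis, of "{e\<^sub>2}"]
    unfolding E\<^sub>2\<^sub>2_def by auto
  have "vec.dim (UNIV :: ('a^2) set) = 2"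
    by (simp only: vec_dim_card) simp
  moreover have "annihilator E\<^sub>2\<^sub>1 = UNIV"
    by (auto simp: annihilator_def E\<^sub>2\<^sub>1_def evolution_product_zero)
  ultimately show ?thesis
    using B2 H1 H2 basis evolution_algebra_evolution_product nilpotent_zero nilpotent_shift
      nilpotent_evolution_algebra_dim_2 not_isomorphic_zero_shift B_forms_zero_product
      algebra_auts_zero_product annihilator_shift algebra_auts_shift
    unfolding E\<^sub>2\<^sub>1_def E\<^sub>2\<^sub>2_def e\<^sub>1_def e\<^sub>2_def by (intro conjI allI impI) blast+
qed

end
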